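(* Let $n\ge 1$ be an integer and let $a,b,k$ be nonnegative integers. Then $$\operatorname{CT}_x \prod_{l=1}^n\left(1-\frac{x_l}{x_0}\right)^{a}\left(1-\frac{x_0}{x_l}\right)^{b}\prod_{1\le i\ne j\le n}\left(1-\frac{x_i}{x_j}\right)^{k}=\prod_{l=0}^{n-1}\frac{(a+b+kl)!\,(k(l+1))!}{(a+kl)!\,(b+kl)!\,k!}.$$
   Context: $\operatorname{CT}_x$ denotes the constant term (the coefficient of $x_0^0x_1^0\cdots x_n^0$) of a Laurent polynomial in $x_0,\ldots,x_n$. The product over $1\le i\neq j\le n$ is over ordered pairs. *)

theory Defs
  imports Complex_Main "HOL-Library.Poly_Mapping"
begin

text \<open>
  Laurent polynomials in the variables \<open>x\<^sub>0, x\<^sub>1, x\<^sub>2, \<dots>\<close> with coefficients in \<open>'a\<close>: finitely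
  supported maps from exponent vectors (finitely supported, with integer entries) to
  coefficients. The multiplication of \<open>Poly_Mapping\<close> is convolution, so this is the group ring of
  the free abelian group of exponent vectors. The Laurent polynomials in \<open>x\<^sub>0, \<dots>, x\<^sub>n\<close> form the
  subring of those involving only exponent vectors supported in \<open>{0..n}\<close>.
\<close>

type_synonym 'a laurent_poly = "(nat \<Rightarrow>\<^sub>0 int) \<Rightarrow>\<^sub>0 'a"

definition lvar :: "nat \<Rightarrow> 'a::comm_ring_1 laurent_poly" where
  "lvar i = Poly_Mapping.single (Poly_Mapping.single i 1) 1"

definition lvar_inv :: "nat \<Rightarrow> 'a::comm_ring_1 laurent_poly" where
  "lvar_inv i = Poly_Mapping.single (Poly_Mapping.single i (- 1)) 1"

lemma lvar_times_lvar_inv: "lvar i * lvar_inv i = 1"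
  by (simp add: lvar_def lvar_inv_def mult_single flip: single_add)

definition lratio :: "nat \<Rightarrow> nat \<Rightarrow> 'a::comm_ring_1 laurent_poly" where
  "lratio i j = lvar i * lvar_inv j"

definition constant_term :: "'a::comm_ring_1 laurent_poly \<Rightarrow> 'a" where
  "constant_term p = Poly_Mapping.lookup p 0"

end

theory Submission
  imports Defs "HOL-Combinatorics.Transposition"
begin

text \<open>
  The identity is Morris's constant term identity, and the proof is Aomoto's method for Selberg
  integrals with the integral replaced by the constant term. Write \<open>y\<^sub>i = x\<^sub>i / x\<^sub>0\<close>, let \<open>W\<close> be
  the Laurent polynomial in question and \<open>P\<^sub>S\<close> the product of the \<open>1 - y\<^sub>s\<close> for \<open>s\<close> in a set \<open>S\<close> of
  indices. Two facts replace integration by parts and changes of variables: the constant term of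
  \<open>x\<^sub>i \<partial>/\<partial>x\<^sub>i g\<close> vanishes for every \<open>g\<close>, and the constant term does not change when the exponent
  vectors are transformed by an automorphism, such as the swap of two variables.

  Take \<open>i\<close> outside \<open>S\<close> and \<open>g = (1 - y\<^sub>i) P\<^sub>S W\<close>. The factors of \<open>g\<close> that compare \<open>x\<^sub>i\<close> with \<open>x\<^sub>0\<close>
  contribute \<open>- ((a + 1) y\<^sub>i + b) P\<^sub>S W\<close> to the derivative, and each other index \<open>j\<close> contributes
  \<open>k (1 - y\<^sub>i) P\<^sub>S W (x\<^sub>i + x\<^sub>j) / (x\<^sub>i - x\<^sub>j)\<close>. The last quotient is antisymmetric under swapping \<open>i\<close>
  and \<open>j\<close>. If \<open>j\<close> lies in \<open>S\<close>, what multiplies it is symmetric and the constant term is zero;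
  otherwise averaging with the swapped expression cancels the denominator and leaves
  \<open>- k P\<^sub>S W y\<^sub>i\<close>. Since \<open>P\<^sub>S y\<^sub>i\<close> is the difference of \<open>P\<^sub>S\<close> and \<open>P\<close> at \<open>S \<union> {i}\<close>, this relates the
  constant terms of \<open>P\<^sub>S W\<close> for \<open>S\<close> and \<open>S \<union> {i}\<close> (\<open>aomoto_step\<close>). Adding all indices to \<open>S\<close> one
  at a time turns \<open>a\<close> into \<open>a + 1\<close> (\<open>constant_term_morris_Suc\<close>).

  It remains to treat \<open>a = 0\<close>. Inverting all variables exchanges \<open>a\<close> and \<open>b\<close>, so the recursion also
  brings \<open>b\<close> down to \<open>0\<close>. With \<open>a = b = 0\<close> the variable \<open>x\<^sub>0\<close> is absent and the product is Dyson's
  product in \<open>n\<close> variables. Regarding one of them as the new \<open>x\<^sub>0\<close>, it is the Morris product in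
  \<open>n - 1\<close> variables with \<open>a = b = k\<close>, so that induction on the number of variables finishes the
  proof (\<open>constant_term_morris\<close>). For this reason the variables are indexed by an arbitrary finite
  set \<open>X\<close>, with an arbitrary index \<open>z\<close> outside \<open>X\<close> in the role of \<open>0\<close>.
\<close>

section \<open>Constant terms, Euler derivations and monomial substitutions\<close>

abbreviation coeff :: "'a::zero laurent_poly \<Rightarrow> (nat \<Rightarrow>\<^sub>0 int) \<Rightarrow> 'a" where
  "coeff \<equiv> Poly_Mapping.lookup"

lemma coeff_mult:
  fixes p q :: "'a::comm_ring_1 laurent_poly"
  assumes "finite A" "Poly_Mapping.keys p \<subseteq> A"
  shows "coeff (p * q) m = (\<Sum>l\<in>A. coeff p l * coeff q (m - l))"
proof -
  have "(\<Sum>u. coeff q u when m = l + u) = coeff q (m - l)" for l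
  proof -
    have "(\<lambda>u. coeff q u when m = l + u) = (\<lambda>u. coeff q u when u = m - l)"
      by (auto simp: fun_eq_iff when_def)
    then show ?thesis by (simp only: Sum_any_when_equal)
  qed
  then have "coeff (p * q) m = (\<Sum>l. coeff p l * coeff q (m - l))"
    by (simp add: lookup_mult)
  also have "\<dots> = (\<Sum>l\<in>A. coeff p l * coeff q (m - l))"
    by (rule Sum_any.expand_superset) (use assms in \<open>auto simp: in_keys_iff subset_iff dest!: mult_not_zero\<close>)
  finally show ?thesis .
qed

lemma constant_term_add: "constant_term (p + q) = constant_term p + constant_term q"
  by (simp add: constant_term_def lookup_add)

lemma constant_term_minus: "constant_term (- p) = - constant_term p"
  by (simp add: constant_term_def)

lemma constant_term_diff: "constant_term (p - q) = constant_term p - constant_term q"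
  by (simp add: constant_term_def lookup_minus)

lemma constant_term_sum: "constant_term (sum f A) = (\<Sum>x\<in>A. constant_term (f x))"
  by (simp add: constant_term_def lookup_sum)

lemma constant_term_of_nat_mult: "constant_term (of_nat c * p) = of_nat c * constant_term p"
  by (induction c) (simp_all add: algebra_simps constant_term_add, simp add: constant_term_def)

lemma lratio_single:
  "lratio i j = Poly_Mapping.single (Poly_Mapping.single i 1 - Poly_Mapping.single j 1) 1"
  by (simp add: lratio_def lvar_def lvar_inv_def mult_single single_uminus)

lemma lratio_self: "lratio i i = 1"
  by (simp add: lratio_single)

lemma lratio_mult: "lratio i j * lratio j l = lratio i l"
  by (simp add: lratio_single mult_single)

text \<open>
  The derivation \<open>x\<^sub>i \<partial>/\<partial>x\<^sub>i\<close>; unlike \<open>\<partial>/\<partial>x\<^sub>i\<close> it multiplies every monomial by a scalar, which is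
  \<open>0\<close> for the constant monomial.
\<close>

definition euler_deriv :: "nat \<Rightarrow> 'a::comm_ring_1 laurent_poly \<Rightarrow> 'a laurent_poly" where
  "euler_deriv i p = Poly_Mapping.mapp (\<lambda>m c. of_int (Poly_Mapping.lookup m i) * c) p"

lemma coeff_euler_deriv:
  "coeff (euler_deriv i p) m = of_int (Poly_Mapping.lookup m i) * coeff p m"
  by (simp add: euler_deriv_def lookup_mapp when_def in_keys_iff)

lemma constant_term_euler_deriv: "constant_term (euler_deriv i p) = 0"
  by (simp add: constant_term_def coeff_euler_deriv)

lemma euler_deriv_diff: "euler_deriv i (p - q) = euler_deriv i p - euler_deriv i q"
  by (rule poly_mapping_eqI) (simp add: coeff_euler_deriv lookup_minus algebra_simps)

lemma euler_deriv_mult: "euler_deriv i (p * q) = euler_deriv i p * q + p * euler_deriv i q"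
proof (rule poly_mapping_eqI)
  fix m
  let ?K = "Poly_Mapping.keys p"
  let ?e = "\<lambda>l :: nat \<Rightarrow>\<^sub>0 int. of_int (Poly_Mapping.lookup l i)"
  have sub: "Poly_Mapping.keys (euler_deriv i p) \<subseteq> ?K"
    by (simp add: euler_deriv_def keys_mapp_subset)
  have "?e m * (coeff p l * coeff q (m - l)) =
      ?e l * coeff p l * coeff q (m - l) + coeff p l * (?e (m - l) * coeff q (m - l))" for l
    by (simp add: lookup_minus algebra_simps)
  then show "coeff (euler_deriv i (p * q)) m =
      coeff (euler_deriv i p * q + p * euler_deriv i q) m"
    unfolding coeff_euler_deriv lookup_add coeff_mult[OF finite_keys sub]
      coeff_mult[OF finite_keys[of p] order_refl]
    by (simp only: sum_distrib_left sum.distrib)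
qed

lemma euler_deriv_one: "euler_deriv i 1 = 0"
  by (rule poly_mapping_eqI) (simp add: coeff_euler_deriv lookup_one when_def)

lemma euler_deriv_power:
  "euler_deriv i (p ^ n) = of_nat n * p ^ (n - 1) * euler_deriv i p"
proof (induction n)
  case (Suc n)
  then show ?case
    by (cases n) (simp_all add: euler_deriv_mult euler_deriv_one algebra_simps)
qed (simp add: euler_deriv_one)

lemma euler_deriv_prod:
  assumes "finite A"
  shows "euler_deriv i (prod f A) = (\<Sum>x\<in>A. euler_deriv i (f x) * prod f (A - {x}))"
  using assms
proof (induction A rule: finite_induct)
  case (insert y A)
  have "prod f (insert y A - {x}) = f y * prod f (A - {x})" if "x \<in> A" for x
  proof -
    have "insert y A - {x} = insert y (A - {x})"
      using that insert.hyps by auto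
    with insert.hyps show ?thesis by simp
  qed
  with insert show ?case
    by (auto simp: euler_deriv_mult sum_distrib_left algebra_simps intro!: sum.cong)
qed (simp add: euler_deriv_one)

lemma euler_deriv_prod_eq_0:
  assumes "\<And>x. x \<in> A \<Longrightarrow> euler_deriv i (f x) = 0"
  shows "euler_deriv i (prod f A) = 0"
  using assms by (cases "finite A") (simp_all add: euler_deriv_prod euler_deriv_one)

lemma euler_deriv_lratio:
  "euler_deriv i (lratio u v) =
    of_int ((if u = i then 1 else 0) - (if v = i then 1 else 0)) * lratio u v"
proof -
  have "euler_deriv i (Poly_Mapping.single m c) =
      of_int (Poly_Mapping.lookup m i) * Poly_Mapping.single m c" for m and c :: 'a
  proof -
    have "of_int (Poly_Mapping.lookup m i) * Poly_Mapping.single m c =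
        Poly_Mapping.single 0 (of_int (Poly_Mapping.lookup m i)) * Poly_Mapping.single m c"
      by simp
    also have "\<dots> = Poly_Mapping.single m (of_int (Poly_Mapping.lookup m i) * c)"
      by (simp only: mult_single add_0_left)
    also have "\<dots> = euler_deriv i (Poly_Mapping.single m c)"
      by (rule poly_mapping_eqI) (simp add: coeff_euler_deriv lookup_single when_def)
    finally show ?thesis by simp
  qed
  then show ?thesis
    by (simp add: lratio_single lookup_minus lookup_single when_def)
qed

text \<open>
  An additive involution of the exponent vectors induces a ring automorphism of the Laurent
  polynomials that preserves the constant term. Being an involution makes precomposition of the
  coefficient function agree with mapping each monomial forward.
\<close>

locale exponent_involution =
  fixes f :: "(nat \<Rightarrow>\<^sub>0 int) \<Rightarrow> (nat \<Rightarrow>\<^sub>0 int)"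
  assumes additive: "f (m + n) = f m + f n" and involutive: "f (f m) = m"
begin

definition subst :: "'a::comm_ring_1 laurent_poly \<Rightarrow> 'a laurent_poly" where
  "subst p = Poly_Mapping.map_key f p"

lemma inj_f: "inj f"
  by (metis involutive injI)

lemma f_0: "f 0 = 0"
  using additive[of 0 0] by simp

lemma f_diff: "f (m - n) = f m - f n"
  using additive[of "m - n" n] by simp

lemma coeff_subst: "coeff (subst p) m = coeff p (f m)"
  by (simp add: subst_def map_key.rep_eq[OF inj_f])

lemma constant_term_subst: "constant_term (subst p) = constant_term p"
  by (simp add: constant_term_def coeff_subst f_0)

lemma subst_add: "subst (p + q) = subst p + subst q"
  by (rule poly_mapping_eqI) (simp add: coeff_subst lookup_add)

lemma subst_diff: "subst (p - q) = subst p - subst q"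
  by (rule poly_mapping_eqI) (simp add: coeff_subst lookup_minus)

lemma subst_single: "subst (Poly_Mapping.single m c) = Poly_Mapping.single (f m) c"
  by (metis subst_def map_key_single[OF inj_f] involutive)

lemma subst_one: "subst 1 = 1"
  using subst_single[of 0 1] by (simp add: f_0)

lemma subst_of_nat: "subst (of_nat c) = of_nat c"
proof (induction c)
  case 0
  show ?case using subst_diff[of 0 0] by simp
qed (simp add: subst_add subst_one)

lemma subst_mult: "subst (p * q) = subst p * subst q"
proof (rule poly_mapping_eqI)
  fix m
  let ?K = "Poly_Mapping.keys p"
  have keys: "Poly_Mapping.keys (subst p) \<subseteq> f ` ?K"
  proof
    fix l assume "l \<in> Poly_Mapping.keys (subst p)"
    then have "f l \<in> ?K" by (simp add: in_keys_iff coeff_subst)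
    then show "l \<in> f ` ?K" using involutive[of l] by (metis imageI)
  qed
  have "coeff (subst p * subst q) m =
      (\<Sum>l\<in>f ` ?K. coeff p (f l) * coeff q (f (m - l)))"
    by (simp add: coeff_mult[OF _ keys] coeff_subst)
  also have "\<dots> = (\<Sum>l\<in>?K. coeff p l * coeff q (f m - l))"
    by (subst sum.reindex) (auto simp: involutive f_diff intro: inj_on_subset[OF inj_f])
  also have "\<dots> = coeff (subst (p * q)) m"
    by (simp add: coeff_subst coeff_mult[OF finite_keys order_refl])
  finally show "coeff (subst (p * q)) m = coeff (subst p * subst q) m" by simp
qed

lemma subst_power: "subst (p ^ n) = subst p ^ n"
  by (induction n) (simp_all add: subst_one subst_mult)

lemma subst_prod: "subst (prod g A) = (\<Prod>x\<in>A. subst (g x))"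
  by (induction A rule: infinite_finite_induct) (simp_all add: subst_one subst_mult)

end

interpretation inversion: exponent_involution uminus
  by unfold_locales simp_all

lemma inversion_lratio: "inversion.subst (lratio i j) = lratio j i"
  by (simp add: lratio_single inversion.subst_single)

lemma inj_transpose: "inj (transpose i j)"
  by (metis injI transpose_involutory)

interpretation swap: exponent_involution "Poly_Mapping.map_key (transpose i j)" for i j
  by unfold_locales
    (simp_all add: map_key_plus inj_transpose map_key_compose map_key_id id_def)

lemma swap_lratio:
  "swap.subst i j (lratio u v) = lratio (transpose i j u) (transpose i j v)"
proof -
  have single: "Poly_Mapping.map_key (transpose i j) (Poly_Mapping.single u c) =
      Poly_Mapping.single (transpose i j u) c" for u and c :: int
    by (metis map_key_single[OF inj_transpose] transpose_involutory)
  show ?thesis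
    by (simp add: lratio_single swap.subst_single swap.f_diff single)
qed

section \<open>The Dyson and Morris products\<close>

definition dyson :: "nat set \<Rightarrow> nat \<Rightarrow> 'a::comm_ring_1 laurent_poly" where
  "dyson X k = (\<Prod>(i, j)\<in>{(i, j). i \<in> X \<and> j \<in> X \<and> i \<noteq> j}. (1 - lratio i j) ^ k)"

definition boundary :: "nat \<Rightarrow> nat set \<Rightarrow> nat \<Rightarrow> nat \<Rightarrow> 'a::comm_ring_1 laurent_poly" where
  "boundary z X a b = (\<Prod>l\<in>X. (1 - lratio l z) ^ a * (1 - lratio z l) ^ b)"

definition morris :: "nat \<Rightarrow> nat set \<Rightarrow> nat \<Rightarrow> nat \<Rightarrow> nat \<Rightarrow> 'a::comm_ring_1 laurent_poly" where
  "morris z X a b k = boundary z X a b * dyson X k"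

definition pair_factor :: "nat \<Rightarrow> nat \<Rightarrow> 'a::comm_ring_1 laurent_poly" where
  "pair_factor i j = (1 - lratio i j) * (1 - lratio j i)"

definition selected :: "nat \<Rightarrow> nat set \<Rightarrow> 'a::comm_ring_1 laurent_poly" where
  "selected z S = (\<Prod>s\<in>S. 1 - lratio s z)"

lemma boundary_insert:
  "finite X \<Longrightarrow> i \<notin> X \<Longrightarrow>
    boundary z (insert i X) a b = (1 - lratio i z) ^ a * (1 - lratio z i) ^ b * boundary z X a b"
  by (simp add: boundary_def)

lemma boundary_zero: "boundary z X 0 0 = 1"
  by (simp add: boundary_def)

lemma dyson_insert:
  assumes "finite X" "i \<notin> X"
  shows "dyson (insert i X) k = dyson X k * (\<Prod>j\<in>X. pair_factor i j ^ k)"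
proof -
  let ?g = "\<lambda>(i, j). (1 - lratio i j) ^ k :: 'a laurent_poly"
  let ?E = "\<lambda>X. {(i, j). i \<in> X \<and> j \<in> X \<and> i \<noteq> j} :: (nat \<times> nat) set"
  have fin: "finite (?E X)"
    by (rule finite_subset[of _ "X \<times> X"]) (use assms in auto)
  have split: "?E (insert i X) = ?E X \<union> (Pair i ` X \<union> (\<lambda>j. (j, i)) ` X)"
    using assms by auto
  have "prod ?g (?E (insert i X)) =
      prod ?g (?E X) * (prod ?g (Pair i ` X) * prod ?g ((\<lambda>j. (j, i)) ` X))"
    unfolding split
    by (subst prod.union_disjoint prod.union_disjoint; use fin assms in auto)+
  also have "prod ?g (Pair i ` X) = (\<Prod>j\<in>X. (1 - lratio i j) ^ k)"
    by (subst prod.reindex) (auto simp: inj_on_def)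
  also have "prod ?g ((\<lambda>j. (j, i)) ` X) = (\<Prod>j\<in>X. (1 - lratio j i) ^ k)"
    by (subst prod.reindex) (auto simp: inj_on_def)
  finally show ?thesis
    by (simp add: dyson_def pair_factor_def power_mult_distrib prod.distrib)
qed

text \<open>
  The factors of Dyson's product that involve a distinguished index \<open>z\<close> are exactly the boundary
  factors with both exponents equal to \<open>k\<close>.
\<close>

lemma dyson_insert_eq_morris:
  assumes "finite X" "z \<notin> X"
  shows "dyson (insert z X) k = morris z X k k k"
  using assms
  by (simp add: dyson_insert morris_def boundary_def pair_factor_def power_mult_distrib
      mult.commute)

subsection \<open>Invariance under swapping two variables\<close>

lemma transpose_mem: "i \<in> X \<Longrightarrow> j \<in> X \<Longrightarrow> transpose i j u \<in> X \<longleftrightarrow> u \<in> X"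
  by (metis transpose_def)

lemma swap_prod:
  assumes "i \<in> X" "j \<in> X" and "\<And>u. swap.subst i j (g u) = g (transpose i j u)"
  shows "swap.subst i j (prod g X) = prod g X"
  unfolding swap.subst_prod assms(3)
  by (rule prod.reindex_bij_witness[of _ "transpose i j" "transpose i j"])
    (use assms in \<open>auto simp: transpose_mem\<close>)

lemma swap_boundary:
  assumes "i \<in> X" "j \<in> X" "z \<notin> X"
  shows "swap.subst i j (boundary z X a b) = boundary z X a b"
proof -
  have "transpose i j z = z" using assms by (metis transpose_apply_other)
  then show ?thesis
    unfolding boundary_def using assms
    by (intro swap_prod)
      (simp_all add: swap.subst_mult swap.subst_power swap.subst_diff swap.subst_one swap_lratio)
qed

lemma swap_dyson:
  assumes "i \<notin> X" "j \<notin> X"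
  shows "swap.subst i j (dyson X k) = dyson X k"
  unfolding dyson_def swap.subst_prod
proof (rule prod.cong)
  fix e assume "e \<in> {(i, j). i \<in> X \<and> j \<in> X \<and> i \<noteq> j}"
  then obtain u v where "e = (u, v)" "u \<notin> {i, j}" "v \<notin> {i, j}" using assms by auto
  then show "swap.subst i j (case e of (i, j) \<Rightarrow> (1 - lratio i j) ^ k) =
      (case e of (i, j) \<Rightarrow> (1 - lratio i j) ^ k)"
    by (simp add: swap.subst_power swap.subst_diff swap.subst_one swap_lratio transpose_def)
qed simp

lemma swap_selected:
  assumes "i \<notin> S" "j \<notin> S" "z \<notin> {i, j}"
  shows "swap.subst i j (selected z S) = selected z S"
  unfolding selected_def swap.subst_prod
  by (rule prod.cong)
    (use assms in \<open>auto simp: swap.subst_diff swap.subst_one swap_lratio transpose_def\<close>)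

section \<open>Aomoto's recursion\<close>

text \<open>
  The Morris product without the two factors that compare \<open>x\<^sub>i\<close> and \<open>x\<^sub>j\<close>, arranged so that its
  symmetry in \<open>i\<close> and \<open>j\<close> is visible.
\<close>

definition pair_free :: "nat \<Rightarrow> nat set \<Rightarrow> nat \<Rightarrow> nat \<Rightarrow> nat \<Rightarrow> nat \<Rightarrow> nat \<Rightarrow>
    'a::comm_ring_1 laurent_poly" where
  "pair_free z X a b k i j = boundary z X a b * dyson (X - {i, j}) k *
    (\<Prod>l\<in>X - {i, j}. pair_factor i l ^ k * pair_factor j l ^ k)"

lemma morris_split_one:
  assumes "finite X" "i \<in> X"
  shows "morris z X a b k =
    boundary z X a b * dyson (X - {i}) k * (\<Prod>j\<in>X - {i}. pair_factor i j ^ k)"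
  using dyson_insert[of "X - {i}" i k, where 'a = 'a] assms
  by (simp add: morris_def insert_absorb mult.assoc)

lemma pair_free_eq:
  assumes "finite X" "i \<in> X" "j \<in> X" "i \<noteq> j"
  shows "boundary z X a b * dyson (X - {i}) k *
    (\<Prod>l\<in>X - {i} - {j}. pair_factor i l ^ k) = pair_free z X a b k i j"
proof -
  have "X - {i} = insert j (X - {i, j})" "X - {i} - {j} = X - {i, j}"
    using assms by auto
  then show ?thesis
    using dyson_insert[of "X - {i, j}" j k, where 'a = 'a] assms
    by (simp add: pair_free_def prod.distrib mult_ac)
qed

lemma morris_split_pair:
  assumes "finite X" "i \<in> X" "j \<in> X" "i \<noteq> j"
  shows "morris z X a b k = pair_free z X a b k i j * pair_factor i j ^ k"
  using assms prod.remove[of "X - {i}" j "\<lambda>l. pair_factor i l ^ k :: 'a laurent_poly"]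
  by (simp add: morris_split_one pair_free_eq[symmetric] mult_ac)

lemma swap_pair_free:
  assumes "i \<in> X" "j \<in> X" "z \<notin> X"
  shows "swap.subst i j (pair_free z X a b k i j) = pair_free z X a b k i j"
proof -
  have "swap.subst i j (\<Prod>l\<in>X - {i, j}. pair_factor i l ^ k * pair_factor j l ^ k) =
      (\<Prod>l\<in>X - {i, j}. pair_factor i l ^ k * pair_factor j l ^ k :: 'a laurent_poly)"
    unfolding swap.subst_prod
    by (rule prod.cong)
      (auto simp: pair_factor_def swap.subst_mult swap.subst_power swap.subst_diff swap.subst_one
        swap_lratio mult.commute)
  with assms show ?thesis
    by (simp add: pair_free_def swap.subst_mult swap_boundary swap_dyson)
qed

lemma swap_pair_factor: "swap.subst i j (pair_factor i j) = pair_factor i j"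
  by (simp add: pair_factor_def swap.subst_mult swap.subst_diff swap.subst_one swap_lratio
      mult.commute)

text \<open>
  The contribution of the pair \<open>{i, j}\<close> to \<open>x\<^sub>i \<partial>/\<partial>x\<^sub>i\<close> of the Morris product. Formally it is
  \<open>k W (x\<^sub>i + x\<^sub>j) / (x\<^sub>i - x\<^sub>j)\<close>; lowering the exponent of the pair factor by one avoids the division.
  For \<open>k = 0\<close> the truncated exponent \<open>k - 1\<close> is harmless because of the factor \<open>k\<close>.
\<close>

definition cross_term :: "nat \<Rightarrow> nat set \<Rightarrow> nat \<Rightarrow> nat \<Rightarrow> nat \<Rightarrow> nat \<Rightarrow> nat \<Rightarrow>
    'a::comm_ring_1 laurent_poly" where
  "cross_term z X a b k i j = pair_free z X a b k i j *
    (of_nat k * pair_factor i j ^ (k - 1) * (lratio j i - lratio i j))"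

lemma swap_cross_term:
  assumes "i \<in> X" "j \<in> X" "z \<notin> X"
  shows "swap.subst i j (cross_term z X a b k i j) = - cross_term z X a b k i j"
  using assms
  by (simp add: cross_term_def swap.subst_mult swap.subst_power swap.subst_diff swap_lratio
      swap.subst_of_nat swap_pair_free swap_pair_factor) (simp add: algebra_simps)

text \<open>
  This is the cancellation of the denominator \<open>x\<^sub>i - x\<^sub>j\<close>. With \<open>u = x\<^sub>i / x\<^sub>j\<close> and \<open>v = 1 / u\<close> it comes
  down to \<open>(1 - u) (v - u) = - (1 + u) (1 - u) (1 - v)\<close>.
\<close>

lemma cross_term_times_difference:
  assumes "finite X" "i \<in> X" "j \<in> X" "i \<noteq> j"
  shows "(lratio j z - lratio i z) * cross_term z X a b k i j =
    - (of_nat k * ((lratio i z + lratio j z) * morris z X a b k))"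
proof -
  have yi: "lratio i z = (lratio i j * lratio j z :: 'a laurent_poly)"
    by (simp add: lratio_mult)
  have uv: "lratio i j * lratio j i = (1 :: 'a laurent_poly)"
    by (simp add: lratio_mult lratio_self)
  define u v y :: "'a laurent_poly" where "u = lratio i j" "v = lratio j i" "y = lratio j z"
  have "(y - u * y) * (v - u) = - ((u * y + y) * ((1 - u) * (1 - v))) "
  proof -
    have "(y - u * y) * (v - u) + (u * y + y) * ((1 - u) * (1 - v)) = (1 - u * v) * (y - u * y)"
      by (simp add: algebra_simps)
    then show ?thesis
      using uv by (simp add: u_v_y_def eq_neg_iff_add_eq_0)
  qed
  then have key: "(lratio j z - lratio i z) * (lratio j i - lratio i j) =
      - ((lratio i z + lratio j z) * (pair_factor i j :: 'a laurent_poly))"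
    unfolding yi pair_factor_def u_v_y_def .
  have "(lratio j z - lratio i z) * (cross_term z X a b k i j :: 'a laurent_poly) =
      pair_free z X a b k i j * (of_nat k * pair_factor i j ^ (k - 1)) *
      ((lratio j z - lratio i z) * (lratio j i - lratio i j))"
    by (simp add: cross_term_def mult_ac)
  also have "\<dots> = - (pair_free z X a b k i j * (of_nat k * (pair_factor i j ^ (k - 1) *
      pair_factor i j)) * (lratio i z + lratio j z))"
    unfolding key by (simp add: mult_ac)
  also have "of_nat k * (pair_factor i j ^ (k - 1) * pair_factor i j) =
      of_nat k * (pair_factor i j ^ k :: 'a laurent_poly)"
    by (cases k) (simp_all add: mult.commute)
  finally show ?thesis
    using assms by (simp add: morris_split_pair mult_ac)
qed

text \<open>
  For \<open>j\<close> in \<open>S\<close> the expression contains \<open>(1 - y\<^sub>i) (1 - y\<^sub>j)\<close>, so it changes sign under the swap of \<open>i\<close>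
  and \<open>j\<close> while its constant term does not. For \<open>j\<close> outside \<open>S\<close> the swap replaces \<open>1 - y\<^sub>i\<close> by
  \<open>- (1 - y\<^sub>j)\<close>; adding both versions leaves \<open>y\<^sub>j - y\<^sub>i\<close> times the cross term, which
  \<open>cross_term_times_difference\<close> evaluates.
\<close>

lemma constant_term_cross_term:
  fixes z a b k i j :: nat and X S :: "nat set"
  defines "W \<equiv> morris z X a b k :: 'a::field_char_0 laurent_poly"
  assumes X: "finite X" "i \<in> X" "j \<in> X" "i \<noteq> j" "z \<notin> X" and S: "S \<subseteq> X" "i \<notin> S"
  shows "constant_term ((1 - lratio i z) * selected z S * cross_term z X a b k i j) =
    (if j \<in> S then 0 else - (of_nat k * constant_term (selected z S * W * lratio i z)))"
proof -
  define T :: "'a laurent_poly" where "T = cross_term z X a b k i j"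
  have halve: "c = - (of_nat k * q)" if "2 * c = - (of_nat k * (q + q))" for c q :: 'a
  proof -
    have "2 * c = 2 * (- (of_nat k * q))"
      using that by (simp add: algebra_simps)
    then show ?thesis
      by (simp only: mult_cancel_left) simp
  qed
  have z: "z \<notin> {i, j}" "transpose i j z = z"
    using X by (auto simp: transpose_def)
  have swapT: "swap.subst i j T = - T"
    using X by (simp add: T_def swap_cross_term)
  have swap_fac: "swap.subst i j (1 - lratio i z) = (1 - lratio j z :: 'a laurent_poly)"
      "swap.subst i j (1 - lratio j z) = (1 - lratio i z :: 'a laurent_poly)"
    using z by (simp_all add: swap.subst_diff swap.subst_one swap_lratio)
  show ?thesis
  proof (cases "j \<in> S")
    case True
    let ?R = "(1 - lratio i z) * ((1 - lratio j z) * selected z (S - {j})) * T"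
    have S': "selected z S = (1 - lratio j z) * (selected z (S - {j}) :: 'a laurent_poly)"
      unfolding selected_def using X S True by (simp add: prod.remove finite_subset)
    have "swap.subst i j ?R = - ?R"
      using S z by (simp add: swap.subst_mult swap_fac swapT swap_selected mult_ac)
    then have "constant_term ?R = - constant_term ?R"
      using swap.constant_term_subst[of i j ?R] by (simp only: constant_term_minus)
    then show ?thesis
      using True by (simp add: S' T_def)
  next
    case False
    let ?P = "selected z S :: 'a laurent_poly"
    have swapP: "swap.subst i j ?P = ?P"
      using S False z by (simp add: swap_selected)
    have "constant_term ((1 - lratio i z) * ?P * T) =
        constant_term (swap.subst i j ((1 - lratio i z) * ?P * T))"
      by (simp only: swap.constant_term_subst)
    also have "swap.subst i j ((1 - lratio i z) * ?P * T) = - ((1 - lratio j z) * ?P * T)"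
      by (simp add: swap.subst_mult swap_fac swapT swapP)
    finally have "2 * constant_term ((1 - lratio i z) * ?P * T) =
        constant_term ((1 - lratio i z) * ?P * T) - constant_term ((1 - lratio j z) * ?P * T)"
      by (simp add: constant_term_minus)
    also have "\<dots> = constant_term (?P * ((lratio j z - lratio i z) * T))"
      by (simp add: algebra_simps flip: constant_term_diff)
    also have "?P * ((lratio j z - lratio i z) * T) =
        - (of_nat k * (?P * W * lratio i z + ?P * W * lratio j z))"
      unfolding T_def W_def cross_term_times_difference[OF X(1-4)] by (simp add: algebra_simps)
    also have "constant_term \<dots> = - (of_nat k *
        (constant_term (?P * W * lratio i z) + constant_term (?P * W * lratio j z)))"
      by (simp only: constant_term_minus constant_term_of_nat_mult constant_term_add)
    also have "constant_term (?P * W * lratio j z) = constant_term (?P * W * lratio i z)"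
    proof -
      have "swap.subst i j W = W"
        using X
        by (simp add: W_def morris_split_pair swap.subst_mult swap.subst_power swap_pair_free
            swap_pair_factor)
      then have "swap.subst i j (?P * W * lratio i z) = ?P * W * lratio j z"
        using z by (simp add: swap.subst_mult swapP swap_lratio)
      then show ?thesis
        using swap.constant_term_subst[of i j "?P * W * lratio i z"] by simp
    qed
    finally have "constant_term ((1 - lratio i z) * ?P * T) =
        - (of_nat k * constant_term (?P * W * lratio i z))"
      by (rule halve)
    then show ?thesis
      unfolding T_def using False by (simp only: if_False)
  qed
qed

lemma euler_deriv_pair_factor:
  assumes "i \<noteq> j"
  shows "euler_deriv i (pair_factor i j ^ k) =
    of_nat k * pair_factor i j ^ (k - 1) * (lratio j i - lratio i j)"
proof -
  have "euler_deriv i (1 - lratio i j) = - (lratio i j :: 'a laurent_poly)"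
      "euler_deriv i (1 - lratio j i) = (lratio j i :: 'a laurent_poly)"
    using assms by (simp_all add: euler_deriv_diff euler_deriv_one euler_deriv_lratio)
  then have "euler_deriv i (pair_factor i j) = (lratio j i - lratio i j :: 'a laurent_poly)"
    by (simp only: pair_factor_def euler_deriv_mult) (simp add: algebra_simps)
  then show ?thesis
    by (simp add: euler_deriv_power)
qed

text \<open>
  The extra factor \<open>1 - y\<close> makes the derivative of \<open>(1 - 1/y)\<^sup>b\<close> a multiple of the undifferentiated
  product, because \<open>(1 - y) / y = - (1 - 1/y)\<close>.
\<close>

lemma euler_deriv_boundary_factor:
  assumes "i \<noteq> z"
  shows "euler_deriv i ((1 - lratio i z) ^ Suc a * (1 - lratio z i) ^ b) =
    - ((of_nat (a + 1) * lratio i z + of_nat b) * ((1 - lratio i z) ^ a * (1 - lratio z i) ^ b))"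
proof -
  define y w :: "'a laurent_poly" where "y = lratio i z" "w = lratio z i"
  have yw: "y * w = 1"
    by (simp add: y_w_def lratio_mult lratio_self)
  have D: "euler_deriv i (1 - y) = - y" "euler_deriv i (1 - w) = w"
    using assms by (simp_all add: y_w_def euler_deriv_diff euler_deriv_one euler_deriv_lratio)
  have cancel: "(1 - y) * w = - (1 - w)"
    using yw by (simp add: algebra_simps)
  have "euler_deriv i ((1 - y) ^ Suc a * (1 - w) ^ b) =
      - (of_nat (a + 1) * y * ((1 - y) ^ a * (1 - w) ^ b)) +
      (1 - y) ^ a * (of_nat b * (1 - w) ^ (b - 1)) * ((1 - y) * w)"
    by (simp only: euler_deriv_mult euler_deriv_power D) (simp add: algebra_simps)
  also have "(1 - y) ^ a * (of_nat b * (1 - w) ^ (b - 1)) * ((1 - y) * w) =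
      - (of_nat b * ((1 - y) ^ a * (1 - w) ^ b))"
    unfolding cancel by (cases b) (simp_all add: algebra_simps)
  finally show ?thesis
    unfolding y_w_def by (simp add: algebra_simps)
qed

lemma euler_deriv_morris:
  assumes X: "finite X" "i \<in> X" "z \<notin> X" and S: "S \<subseteq> X" "i \<notin> S"
  shows "euler_deriv i ((1 - lratio i z) * selected z S * morris z X a b k) =
    - (of_nat (a + 1) * (selected z S * morris z X a b k * lratio i z))
    - of_nat b * (selected z S * morris z X a b k)
    + (\<Sum>j\<in>X - {i}. (1 - lratio i z) * selected z S * cross_term z X a b k i j)"
proof -
  let ?Z = "X - {i}"
  \<comment> \<open>\<open>A0\<close>, \<open>A1\<close> and \<open>Q\<close> collect the factors involving \<open>x\<^sub>i\<close>; \<open>C\<close> and \<open>P\<close> are constants for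
    the derivation.\<close>
  define A0 A1 Q C P :: "'a laurent_poly" where
    "A0 = (1 - lratio i z) ^ a * (1 - lratio z i) ^ b"
    "A1 = (1 - lratio i z) ^ Suc a * (1 - lratio z i) ^ b"
    "Q = (\<Prod>j\<in>?Z. pair_factor i j ^ k)"
    "C = boundary z ?Z a b * dyson ?Z k"
    "P = selected z S"
  note defs = this
  have iz: "i \<noteq> z" using X by auto
  have A1: "A1 = (1 - lratio i z) * A0"
    by (simp add: defs)
  have boundary: "boundary z X a b = A0 * boundary z ?Z a b"
    using boundary_insert[of ?Z i z a b] X by (simp add: defs insert_absorb)
  have W: "morris z X a b k = A0 * C * Q"
    using X by (simp add: morris_split_one boundary defs mult_ac)
  have D_indep: "euler_deriv i ((1 - lratio u v) ^ n) = (0 :: 'a laurent_poly)" if "u \<noteq> i" "v \<noteq> i" for u v n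
    using that by (simp add: euler_deriv_power euler_deriv_diff euler_deriv_one euler_deriv_lratio)
  have DC: "euler_deriv i C = 0"
    unfolding defs boundary_def dyson_def euler_deriv_mult
    using iz by (subst (1 2) euler_deriv_prod_eq_0) (auto simp: euler_deriv_mult D_indep)
  have DP: "euler_deriv i P = 0"
    unfolding defs selected_def
  proof (rule euler_deriv_prod_eq_0)
    fix s assume "s \<in> S"
    with S have "s \<noteq> i" by auto
    then show "euler_deriv i (1 - lratio s z) = (0 :: 'a laurent_poly)"
      using D_indep[of s z 1] iz by simp
  qed
  have DQ: "euler_deriv i Q = (\<Sum>j\<in>?Z. of_nat k * pair_factor i j ^ (k - 1) *
      (lratio j i - lratio i j) * (\<Prod>l\<in>?Z - {j}. pair_factor i l ^ k))"
    unfolding defs using X by (simp add: euler_deriv_prod euler_deriv_pair_factor)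
  have cross: "A0 * C * (of_nat k * pair_factor i j ^ (k - 1) *
      (lratio j i - lratio i j) * (\<Prod>l\<in>?Z - {j}. pair_factor i l ^ k)) =
      cross_term z X a b k i j" if "j \<in> ?Z" for j
  proof -
    have "pair_free z X a b k i j = A0 * C * (\<Prod>l\<in>?Z - {j}. pair_factor i l ^ k)"
      using that X pair_free_eq[of X i j z a b k, where 'a = 'a]
      by (simp add: boundary defs(4) mult_ac)
    then show ?thesis
      by (simp only: cross_term_def mult_ac)
  qed
  have "euler_deriv i ((1 - lratio i z) * P * morris z X a b k) =
      euler_deriv i (A1 * (P * C * Q))"
    unfolding W A1 by (simp add: mult_ac)
  also have "\<dots> = euler_deriv i A1 * (P * C * Q) + A1 * (P * C * euler_deriv i Q)"
    by (simp add: euler_deriv_mult DC DP)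
  also have "euler_deriv i A1 * (P * C * Q) =
      - (of_nat (a + 1) * (P * morris z X a b k * lratio i z)) - of_nat b * (P * morris z X a b k)"
    unfolding defs(2) euler_deriv_boundary_factor[OF iz] unfolding W unfolding defs(1)
    by (simp add: algebra_simps)
  also have "A1 * (P * C * euler_deriv i Q) =
      (\<Sum>j\<in>?Z. (1 - lratio i z) * P * cross_term z X a b k i j)"
    unfolding DQ A1 sum_distrib_left
    by (rule sum.cong) (simp_all add: mult_ac flip: cross)
  finally show ?thesis
    unfolding defs(5) .
qed

text \<open>
  The constant term of the derivative in \<open>euler_deriv_morris\<close> is zero. Of the other indices \<open>j\<close>,
  exactly the \<open>card X - 1 - card S\<close> many outside \<open>S\<close> contribute, each the same amount.
\<close>

lemma aomoto_step:
  fixes z a b k i :: nat and X S :: "nat set"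
  defines "W \<equiv> morris z X a b k :: 'a::field_char_0 laurent_poly"
  assumes X: "finite X" "i \<in> X" "z \<notin> X" and S: "S \<subseteq> X" "i \<notin> S"
  shows "of_nat (a + 1 + k * (card X - 1 - card S)) * constant_term (selected z (insert i S) * W) =
    of_nat (a + 1 + b + k * (card X - 1 - card S)) * constant_term (selected z S * W)"
proof -
  let ?P = "selected z S :: 'a laurent_poly"
  let ?m = "card X - 1 - card S"
  define p where "p = constant_term (?P * W)"
  define q where "q = constant_term (?P * W * lratio i z)"
  have finS: "finite S" using X S finite_subset by blast
  have card_rest: "card (X - {i} - S) = ?m"
    using X S finS by (subst card_Diff_subset) auto
  have "(\<Sum>j\<in>X - {i}. constant_term ((1 - lratio i z) * ?P * cross_term z X a b k i j)) =
      (\<Sum>j\<in>X - {i}. if j \<in> S then 0 else - (of_nat k * q))"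
    unfolding q_def W_def using X S by (intro sum.cong constant_term_cross_term) auto
  also have "\<dots> = (\<Sum>j\<in>X - {i} - S. - (of_nat k * q))"
    using X by (intro sum.mono_neutral_cong_right) auto
  finally have cross:
    "(\<Sum>j\<in>X - {i}. constant_term ((1 - lratio i z) * ?P * cross_term z X a b k i j)) =
      - (of_nat (k * ?m) * q)"
    by (simp only: sum_constant card_rest of_nat_mult) simp
  have "0 = constant_term (euler_deriv i ((1 - lratio i z) * ?P * W))"
    by (simp add: constant_term_euler_deriv)
  also have "\<dots> = - (of_nat (a + 1) * q) - of_nat b * p - of_nat (k * ?m) * q"
    unfolding W_def euler_deriv_morris[OF X S]
    by (simp only: constant_term_add constant_term_diff constant_term_minus constant_term_sum
        constant_term_of_nat_mult cross) (simp add: p_def q_def W_def)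
  finally have "of_nat (a + 1 + k * ?m) * (p - q) = of_nat (a + 1 + b + k * ?m) * p"
    by (simp add: algebra_simps)
  moreover have "constant_term (selected z (insert i S) * W) = p - q"
    using S finS by (simp add: selected_def p_def q_def algebra_simps flip: constant_term_diff)
  ultimately show ?thesis
    by (simp add: p_def)
qed

lemma constant_term_selected:
  fixes z a b k :: nat and X S :: "nat set"
  defines "W \<equiv> morris z X a b k :: 'a::field_char_0 laurent_poly"
  assumes X: "finite X" "z \<notin> X" and S: "S \<subseteq> X"
  shows "constant_term (selected z S * W) * (\<Prod>r<card S. of_nat (a + 1 + k * (card X - 1 - r))) =
    constant_term W * (\<Prod>r<card S. of_nat (a + 1 + b + k * (card X - 1 - r)))"
proof -
  have "finite S" using X S finite_subset by blast
  then show ?thesis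
    using S
  proof (induction S rule: finite_induct)
    case empty
    then show ?case by (simp add: selected_def)
  next
    case (insert i S)
    let ?d = "\<lambda>r. of_nat (a + 1 + k * (card X - 1 - r)) :: 'a"
    let ?e = "\<lambda>r. of_nat (a + 1 + b + k * (card X - 1 - r)) :: 'a"
    have step: "?d (card S) * constant_term (selected z (insert i S) * W) =
        ?e (card S) * constant_term (selected z S * W)"
      unfolding W_def using insert X by (intro aomoto_step) auto
    have IH: "constant_term (selected z S * W) * prod ?d {..<card S} =
        constant_term W * prod ?e {..<card S}"
      using insert by blast
    have card: "card (insert i S) = Suc (card S)"
      using insert.hyps by simp
    have "constant_term (selected z (insert i S) * W) * prod ?d {..<card (insert i S)} =
        (?d (card S) * constant_term (selected z (insert i S) * W)) * prod ?d {..<card S}"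
      by (simp only: card prod.lessThan_Suc mult_ac)
    also have "\<dots> = ?e (card S) * (constant_term (selected z S * W) * prod ?d {..<card S})"
      by (simp only: step mult.assoc)
    also have "\<dots> = constant_term W * prod ?e {..<card (insert i S)}"
      unfolding IH by (simp only: card prod.lessThan_Suc mult_ac)
    finally show ?case .
  qed
qed

text \<open>
  Selecting all of \<open>X\<close> multiplies the Morris product by every \<open>1 - y\<^sub>l\<close>, that is, raises \<open>a\<close> by one.
\<close>

lemma constant_term_morris_Suc:
  assumes "finite X" "z \<notin> X"
  shows "constant_term (morris z X (Suc a) b k :: 'a::field_char_0 laurent_poly) *
      (\<Prod>l<card X. of_nat (a + 1 + k * l)) =
    constant_term (morris z X a b k) * (\<Prod>l<card X. of_nat (a + 1 + b + k * l))"
proof -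
  have "selected z X * morris z X a b k = (morris z X (Suc a) b k :: 'a laurent_poly)"
    by (simp add: selected_def morris_def boundary_def mult_ac flip: prod.distrib)
  moreover have "(\<Prod>r<card X. of_nat (c + k * (card X - 1 - r))) =
      (\<Prod>l<card X. of_nat (c + k * l) :: 'a)" for c
    using prod.nat_diff_reindex[of "\<lambda>l. of_nat (c + k * l) :: 'a" "card X"] by simp
  ultimately show ?thesis
    using constant_term_selected[OF assms order_refl, of a b k, where 'a = 'a] by (simp only:)
qed

section \<open>The closed form\<close>

definition morris_value :: "nat \<Rightarrow> nat \<Rightarrow> nat \<Rightarrow> nat \<Rightarrow> 'a::field_char_0" where
  "morris_value n a b k = (\<Prod>l<n. (fact (a + b + k * l) * fact (k * (l + 1)))
    / (fact (a + k * l) * fact (b + k * l) * fact k))"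

lemma morris_value_Suc:
  "(morris_value n (Suc a) b k :: 'a::field_char_0) * (\<Prod>l<n. of_nat (a + 1 + k * l)) =
    morris_value n a b k * (\<Prod>l<n. of_nat (a + 1 + b + k * l))"
  unfolding morris_value_def prod.distrib[symmetric]
proof (rule prod.cong)
  fix l
  have "of_nat (a + 1 + k * l) \<noteq> (0 :: 'a)"
    by (simp only: of_nat_eq_0_iff)
  moreover have "fact (Suc a + b + k * l) = of_nat (a + 1 + b + k * l) * (fact (a + b + k * l) :: 'a)"
      "fact (Suc a + k * l) = of_nat (a + 1 + k * l) * (fact (a + k * l) :: 'a)"
    by (simp_all add: algebra_simps)
  ultimately show "(fact (Suc a + b + k * l) * fact (k * (l + 1)))
      / (fact (Suc a + k * l) * fact (b + k * l) * fact k) * of_nat (a + 1 + k * l) =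
    (fact (a + b + k * l) * fact (k * (l + 1))) / (fact (a + k * l) * fact (b + k * l) * fact k)
      * (of_nat (a + 1 + b + k * l) :: 'a)"
    by (simp add: mult_ac del: of_nat_add of_nat_mult of_nat_Suc fact_Suc)
qed simp

lemma morris_value_zero_left:
  "(morris_value n 0 b k :: 'a::field_char_0) = (\<Prod>l<n. fact (k * (l + 1)) / (fact (k * l) * fact k))"
  by (simp add: morris_value_def)

text \<open>
  Both sides equal \<open>(k (n + 1))! / k!\<^sup>n\<^sup>+\<^sup>1\<close>: the closed form is consistent with rereading Dyson's
  product in \<open>n + 1\<close> variables as a Morris product in \<open>n\<close> variables.
\<close>

lemma morris_value_dyson:
  "(morris_value (Suc n) 0 b k :: 'a::field_char_0) = morris_value n k k k"
proof (induction n)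
  case 0
  then show ?case by (simp add: morris_value_def)
next
  case (Suc n)
  have "(morris_value (Suc (Suc n)) 0 b k :: 'a) =
      morris_value (Suc n) 0 b k * (fact (k * (n + 2)) / (fact (k * (n + 1)) * fact k))"
    by (simp add: morris_value_zero_left)
  also have "\<dots> = morris_value (Suc n) k k k"
    unfolding Suc by (simp add: morris_value_def algebra_simps)
  finally show ?case .
qed

lemma constant_term_morris_reduce:
  assumes "finite X" "z \<notin> X"
    and "constant_term (morris z X 0 b k :: 'a::field_char_0 laurent_poly) =
      morris_value (card X) 0 b k"
  shows "constant_term (morris z X a b k :: 'a laurent_poly) = morris_value (card X) a b k"
proof (induction a)
  case 0
  then show ?case using assms(3) by simp
next
  case (Suc a)
  have "(\<Prod>l<card X. of_nat (a + 1 + k * l)) \<noteq> (0 :: 'a)"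
  proof -
    have "of_nat (a + 1 + k * l) \<noteq> (0 :: 'a)" for l
      by (simp only: of_nat_eq_0_iff)
    then show ?thesis
      by (simp only: prod_zero_iff finite_lessThan) blast
  qed
  moreover have "constant_term (morris z X (Suc a) b k :: 'a laurent_poly) *
      (\<Prod>l<card X. of_nat (a + 1 + k * l)) =
      morris_value (card X) (Suc a) b k * (\<Prod>l<card X. of_nat (a + 1 + k * l))"
    unfolding constant_term_morris_Suc[OF assms(1,2)] Suc morris_value_Suc ..
  ultimately show ?case
    by (metis mult_right_cancel)
qed

lemma constant_term_morris_flip:
  "constant_term (morris z X a b k) = constant_term (morris z X b a k)"
proof -
  have "inversion.subst (dyson X k) = (dyson X k :: 'a laurent_poly)"
    unfolding dyson_def inversion.subst_prod
    by (rule prod.reindex_bij_witness[of _ prod.swap prod.swap])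
      (auto simp: inversion.subst_power inversion.subst_diff inversion.subst_one inversion_lratio)
  then have "inversion.subst (morris z X a b k) = (morris z X b a k :: 'a laurent_poly)"
    by (simp add: morris_def boundary_def inversion.subst_mult inversion.subst_prod
        inversion.subst_power inversion.subst_diff inversion.subst_one inversion_lratio mult.commute)
  then show ?thesis
    using inversion.constant_term_subst[of "morris z X a b k :: 'a laurent_poly"] by simp
qed

lemma constant_term_morris:
  assumes "finite X" "z \<notin> X"
  shows "constant_term (morris z X a b k :: 'a::field_char_0 laurent_poly) =
    morris_value (card X) a b k"
  using assms
proof (induction X arbitrary: z a b rule: finite_induct)
  case empty
  then show ?case
    by (simp add: morris_def boundary_def dyson_def morris_value_def constant_term_def)
next
  case (insert w X)
  let ?Y = "insert w X"
  \<comment> \<open>The inserted index \<open>w\<close> takes over the role of \<open>z\<close>.\<close>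
  have "constant_term (morris z ?Y 0 0 k :: 'a laurent_poly) = constant_term (morris w X k k k)"
    using insert.hyps by (simp add: morris_def[of z] boundary_zero dyson_insert_eq_morris)
  also have "\<dots> = morris_value (card ?Y) 0 0 k"
    using insert by (simp add: morris_value_dyson)
  finally have base: "constant_term (morris z ?Y 0 0 k :: 'a laurent_poly) =
      morris_value (card ?Y) 0 0 k" .
  \<comment> \<open>The recursion only moves the first exponent, so \<open>b\<close> is brought there by the flip.\<close>
  have "constant_term (morris z ?Y 0 b k :: 'a laurent_poly) = constant_term (morris z ?Y b 0 k)"
    by (rule constant_term_morris_flip)
  also have "\<dots> = morris_value (card ?Y) b 0 k"
    by (rule constant_term_morris_reduce[OF _ insert.prems base]) (simp add: insert.hyps)
  also have "\<dots> = morris_value (card ?Y) 0 b k"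
    by (simp add: morris_value_def mult_ac)
  finally show ?case
    by (rule constant_term_morris_reduce[OF _ insert.prems, rotated]) (simp add: insert.hyps)
qed

theorem theorem1p2:
  fixes n a b k :: nat
  assumes "n \<ge> 1"
  shows "constant_term
      ((\<Prod>l\<in>{1..n}. (1 - lratio l 0) ^ a * (1 - lratio 0 l) ^ b) *
       (\<Prod>(i, j)\<in>{(i, j). i \<in> {1..n} \<and> j \<in> {1..n} \<and> i \<noteq> j}. (1 - lratio i j) ^ k))
    = (\<Prod>l = 0..n - 1.
        (fact (a + b + k * l) * fact (k * (l + 1)))
        / (fact (a + k * l) * fact (b + k * l) * fact k) :: 'c::field_char_0)"
proof -
  have "{0..n - 1} = {..<n}"
    using assms by auto
  then show ?thesis
    using constant_term_morris[of "{1..n}" 0 a b k, where 'a = 'c]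
    by (simp add: morris_def boundary_def dyson_def morris_value_def)
qed

end
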